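(* Every punctual equivalence relation $R_Z$ (with $Z\subseteq\omega$) is join-reducible in $\mathbf{Peq}$; that is, there are punctual equivalence relations $S_0,S_1$ with $S_0<_{pr}R_Z$ and $S_1<_{pr}R_Z$ such that the degree of $R_Z$ is the join in $\mathbf{Peq}$ of the degrees of $S_0$ and $S_1$.
   Context: A punctual equivalence relation is a primitive recursive equivalence relation with domain $\omega$ having infinitely many equivalence classes. For equivalence relations $R,S$ on $\omega$, $R\leq_{pr} S$ means that there is a primitive recursive function $f:\omega\to\omega$ such that for all $x,y\in\omega$, $x\mathrel{R}y \Leftrightarrow f(x)\mathrel{S}f(y)$; $R<_{pr}S$ means $R\leq_{pr}S$ and $S\not\leq_{pr}R$; $R\equiv_{pr}S$ means $R\leq_{pr}S$ and $S\leq_{pr}R$. $\mathbf{Peq}$ is the partial order of $\equiv_{pr}$-classes of punctual equivalence relations, ordered by the order induced by $\leq_{pr}$. For $Z\subseteq\omega$, $R_Z$ is the equivalence relation given by $x\mathrel{R_Z}y \Leftrightarrow (x,y\in Z \text{ or } x=y)$. In a poset $\langle P,\leq\rangle$, an element $a$ is join-reducible if there are $b,c<a$ in $P$ such that $a$ is the join of $b,c$; this is applied to an equivalence relation by referring to its degree in $\mathbf{Peq}$. *)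

theory Defs
  imports "HOL-Algebra.Order"
begin

section \<open>Primitive recursive functions and relations\<close>

text \<open>
  \<open>prim_rec n f\<close>: \<open>f\<close> computes a primitive recursive function of \<open>n\<close> arguments, passed as a
  list. Only the values of \<open>f\<close> on lists of length \<open>n\<close> are meaningful. In \<open>rec\<close> the recursion
  variable comes first, and the step function receives the previous stage, the previous value and
  the parameters, in this order.
\<close>

inductive prim_rec :: "nat \<Rightarrow> (nat list \<Rightarrow> nat) \<Rightarrow> bool" where
  zero: "prim_rec n (\<lambda>xs. 0)"
| succ: "prim_rec 1 (\<lambda>xs. Suc (xs ! 0))"
| proj: "i < n \<Longrightarrow> prim_rec n (\<lambda>xs. xs ! i)"
| comp: "prim_rec (length gs) f \<Longrightarrow> (\<forall>g\<in>set gs. prim_rec n g) \<Longrightarrow>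
    prim_rec n (\<lambda>xs. f (map (\<lambda>g. g xs) gs))"
| rec: "prim_rec n f \<Longrightarrow> prim_rec (Suc (Suc n)) g \<Longrightarrow>
    prim_rec (Suc n) (\<lambda>xs. rec_nat (f (tl xs)) (\<lambda>k r. g (k # r # tl xs)) (hd xs))"

definition prim_rec_fun :: "(nat \<Rightarrow> nat) \<Rightarrow> bool" where
  "prim_rec_fun f \<longleftrightarrow> (\<exists>g. prim_rec 1 g \<and> (\<forall>x. f x = g [x]))"

definition prim_rec_rel :: "(nat \<times> nat) set \<Rightarrow> bool" where
  "prim_rec_rel R \<longleftrightarrow>
    (\<exists>g. prim_rec 2 g \<and> (\<forall>x y. g [x, y] = (if (x, y) \<in> R then 1 else 0)))"

section \<open>Punctual equivalence relations\<close>

definition punctual :: "(nat \<times> nat) set \<Rightarrow> bool" where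
  "punctual R \<longleftrightarrow> equiv UNIV R \<and> prim_rec_rel R \<and> infinite (UNIV // R)"

definition pr_le :: "(nat \<times> nat) set \<Rightarrow> (nat \<times> nat) set \<Rightarrow> bool" (infix \<open>\<le>pr\<close> 50) where
  "R \<le>pr S \<longleftrightarrow> (\<exists>f. prim_rec_fun f \<and> (\<forall>x y. (x, y) \<in> R \<longleftrightarrow> (f x, f y) \<in> S))"

definition pr_less :: "(nat \<times> nat) set \<Rightarrow> (nat \<times> nat) set \<Rightarrow> bool" (infix \<open><pr\<close> 50) where
  "R <pr S \<longleftrightarrow> R \<le>pr S \<and> \<not> S \<le>pr R"

definition pr_equiv :: "(nat \<times> nat) set \<Rightarrow> (nat \<times> nat) set \<Rightarrow> bool" (infix \<open>\<equiv>pr\<close> 50) where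
  "R \<equiv>pr S \<longleftrightarrow> R \<le>pr S \<and> S \<le>pr R"

definition rel_of_set :: "nat set \<Rightarrow> (nat \<times> nat) set" where
  "rel_of_set Z = {(x, y). x \<in> Z \<and> y \<in> Z \<or> x = y}"

section \<open>The degree structure\<close>

definition peq_degree :: "(nat \<times> nat) set \<Rightarrow> (nat \<times> nat) set set" where
  "peq_degree R = {S. punctual S \<and> R \<equiv>pr S}"

definition Peq :: "(nat \<times> nat) set set gorder" where
  "Peq = \<lparr>carrier = {peq_degree R |R. punctual R}, eq = (=),
          le = (\<lambda>A B. \<exists>R\<in>A. \<exists>S\<in>B. R \<le>pr S)\<rparr>"

definition join_reducible :: "('a, 'b) gorder_scheme \<Rightarrow> 'a \<Rightarrow> bool" where
  "join_reducible P a \<longleftrightarrow> a \<in> carrier P \<and>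
    (\<exists>b\<in>carrier P. \<exists>c\<in>carrier P. b \<sqsubset>\<^bsub>P\<^esub> a \<and> c \<sqsubset>\<^bsub>P\<^esub> a \<and> is_lub P a {b, c})"

subsection \<open>Basic properties\<close>

lemma pr_le_refl: "R \<le>pr R"
proof -
  have "prim_rec 1 (\<lambda>xs. xs ! 0)" by (rule prim_rec.proj) simp
  then have "prim_rec_fun (\<lambda>x. x)" unfolding prim_rec_fun_def by (intro exI conjI) auto
  then show ?thesis unfolding pr_le_def by (intro exI[of _ "\<lambda>x. x"]) simp
qed

lemma pr_le_trans:
  assumes "R \<le>pr S" "S \<le>pr T"
  shows "R \<le>pr T"
proof -
  from assms obtain f f' where f: "prim_rec_fun f" "\<And>x y. (x, y) \<in> R \<longleftrightarrow> (f x, f y) \<in> S"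
    and f': "prim_rec_fun f'" "\<And>x y. (x, y) \<in> S \<longleftrightarrow> (f' x, f' y) \<in> T"
    unfolding pr_le_def by blast
  from f(1) f'(1) obtain g g' where g: "prim_rec 1 g" "\<And>x. f x = g [x]"
    and g': "prim_rec 1 g'" "\<And>x. f' x = g' [x]"
    unfolding prim_rec_fun_def by blast
  have "prim_rec 1 (\<lambda>xs. g' (map (\<lambda>h. h xs) [g]))"
    by (rule prim_rec.comp) (use g g' in auto)
  then have "prim_rec_fun (\<lambda>x. f' (f x))"
    unfolding prim_rec_fun_def by (intro exI conjI) (auto simp: g g')
  with f(2) f'(2) show ?thesis unfolding pr_le_def by (intro exI[of _ "\<lambda>x. f' (f x)"]) simp
qed

lemma mem_degree: "punctual R \<Longrightarrow> R \<in> peq_degree R"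
  by (simp add: peq_degree_def pr_equiv_def pr_le_refl)

lemma degree_eq_iff:
  assumes "punctual R" "punctual S"
  shows "peq_degree R = peq_degree S \<longleftrightarrow> R \<equiv>pr S"
proof
  assume "peq_degree R = peq_degree S"
  then have "S \<in> peq_degree R" using assms mem_degree by simp
  then show "R \<equiv>pr S" by (simp add: peq_degree_def)
next
  assume "R \<equiv>pr S"
  then show "peq_degree R = peq_degree S"
    by (auto simp: peq_degree_def pr_equiv_def intro: pr_le_trans)
qed

lemma degree_le_iff:
  assumes "punctual R" "punctual S"
  shows "peq_degree R \<sqsubseteq>\<^bsub>Peq\<^esub> peq_degree S \<longleftrightarrow> R \<le>pr S"
proof
  assume "peq_degree R \<sqsubseteq>\<^bsub>Peq\<^esub> peq_degree S"
  then show "R \<le>pr S"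
    by (auto simp: Peq_def peq_degree_def pr_equiv_def intro: pr_le_trans)
next
  assume "R \<le>pr S"
  then show "peq_degree R \<sqsubseteq>\<^bsub>Peq\<^esub> peq_degree S"
    using mem_degree[OF assms(1)] mem_degree[OF assms(2)] by (auto simp: Peq_def)
qed

lemma degree_less_iff:
  assumes "punctual R" "punctual S"
  shows "peq_degree R \<sqsubset>\<^bsub>Peq\<^esub> peq_degree S \<longleftrightarrow> R <pr S"
  using degree_le_iff[OF assms] degree_eq_iff[OF assms]
  by (auto simp: lless_def pr_less_def pr_equiv_def Peq_def)

lemma degree_in_carrier: "punctual R \<Longrightarrow> peq_degree R \<in> carrier Peq"
  by (auto simp: Peq_def)

lemma carrier_PeqE:
  assumes "a \<in> carrier Peq"
  obtains R where "punctual R" "a = peq_degree R"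
  using assms by (auto simp: Peq_def)

lemma Peq_partial_order: "partial_order Peq"
proof -
  have eq: "(.=\<^bsub>Peq\<^esub>) = (=)" by (simp add: Peq_def)
  show ?thesis
  proof (unfold_locales, goal_cases)
    case (4 x)
    then show ?case by (elim carrier_PeqE) (simp add: degree_le_iff pr_le_refl)
  next
    case (5 x y)
    from 5(3,4) obtain R S where "punctual R" "x = peq_degree R" "punctual S" "y = peq_degree S"
      by (elim carrier_PeqE)
    with 5(1,2) show ?case by (simp add: eq degree_le_iff degree_eq_iff pr_equiv_def)
  next
    case (6 x y z)
    from 6(3-5) obtain R S T where "punctual R" "x = peq_degree R" "punctual S" "y = peq_degree S"
      "punctual T" "z = peq_degree T"
      by (elim carrier_PeqE)
    with 6(1,2) show ?case by (auto simp: degree_le_iff intro: pr_le_trans)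
  qed (simp_all add: eq)
qed

lemma join_reducible_degree_iff:
  assumes "punctual R"
  shows "join_reducible Peq (peq_degree R) \<longleftrightarrow>
    (\<exists>S0 S1. punctual S0 \<and> punctual S1 \<and> S0 <pr R \<and> S1 <pr R \<and>
      (\<forall>T. punctual T \<longrightarrow> S0 \<le>pr T \<longrightarrow> S1 \<le>pr T \<longrightarrow> R \<le>pr T))"
    (is "?L \<longleftrightarrow> ?R")
proof -
  have lub: "is_lub Peq (peq_degree R) {peq_degree S0, peq_degree S1} \<longleftrightarrow>
      S0 \<le>pr R \<and> S1 \<le>pr R \<and> (\<forall>T. punctual T \<longrightarrow> S0 \<le>pr T \<longrightarrow> S1 \<le>pr T \<longrightarrow> R \<le>pr T)"
    if "punctual S0" "punctual S1" for S0 S1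
  proof -
    have up: "peq_degree T \<in> Upper Peq {peq_degree S0, peq_degree S1} \<longleftrightarrow> S0 \<le>pr T \<and> S1 \<le>pr T"
      if "punctual T" for T
      using that \<open>punctual S0\<close> \<open>punctual S1\<close>
      by (auto simp: Upper_def degree_in_carrier degree_le_iff)
    have "(\<forall>u\<in>Upper Peq {peq_degree S0, peq_degree S1}. peq_degree R \<sqsubseteq>\<^bsub>Peq\<^esub> u) \<longleftrightarrow>
        (\<forall>T. punctual T \<longrightarrow> S0 \<le>pr T \<longrightarrow> S1 \<le>pr T \<longrightarrow> R \<le>pr T)" (is "?A \<longleftrightarrow> ?B")
    proof
      assume A: ?A
      show ?B
      proof (intro allI impI)
        fix T assume T: "punctual T" "S0 \<le>pr T" "S1 \<le>pr T"
        then have "peq_degree T \<in> Upper Peq {peq_degree S0, peq_degree S1}"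
          by (simp add: up)
        with A have "peq_degree R \<sqsubseteq>\<^bsub>Peq\<^esub> peq_degree T" by (rule bspec)
        then show "R \<le>pr T" using degree_le_iff[OF assms T(1)] by simp
      qed
    next
      assume B: ?B
      show ?A
      proof
        fix u assume u: "u \<in> Upper Peq {peq_degree S0, peq_degree S1}"
        then have "u \<in> carrier Peq" by (simp add: Upper_def)
        then obtain T where T: "punctual T" "u = peq_degree T" by (rule carrier_PeqE)
        from u T have "S0 \<le>pr T" "S1 \<le>pr T" using up[OF T(1)] by simp_all
        with B T(1) have "R \<le>pr T" by blast
        then show "peq_degree R \<sqsubseteq>\<^bsub>Peq\<^esub> u" using degree_le_iff[OF assms T(1)] T(2) by simp
      qed
    qed
    with up[OF assms] show ?thesis by (simp add: least_def)
  qed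
  show ?thesis
  proof
    assume ?L
    then obtain b c where bc: "b \<in> carrier Peq" "c \<in> carrier Peq" "b \<sqsubset>\<^bsub>Peq\<^esub> peq_degree R"
      "c \<sqsubset>\<^bsub>Peq\<^esub> peq_degree R" "is_lub Peq (peq_degree R) {b, c}"
      unfolding join_reducible_def by blast
    from bc(1,2) obtain S0 S1 where S: "punctual S0" "b = peq_degree S0" "punctual S1" "c = peq_degree S1"
      by (elim carrier_PeqE)
    show ?R
    proof (intro exI conjI)
      show "punctual S0" "punctual S1" by fact+
      show "S0 <pr R" "S1 <pr R"
        using bc(3,4) S assms by (simp_all add: degree_less_iff)
      show "\<forall>T. punctual T \<longrightarrow> S0 \<le>pr T \<longrightarrow> S1 \<le>pr T \<longrightarrow> R \<le>pr T"
        using bc(5) lub[OF S(1,3)] S(2,4) by simp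
    qed
  next
    assume ?R
    then obtain S0 S1 where S: "punctual S0" "punctual S1" and less: "S0 <pr R" "S1 <pr R"
      and ub: "\<forall>T. punctual T \<longrightarrow> S0 \<le>pr T \<longrightarrow> S1 \<le>pr T \<longrightarrow> R \<le>pr T"
      by (elim exE conjE)
    have "is_lub Peq (peq_degree R) {peq_degree S0, peq_degree S1}"
      using lub[OF S] less ub by (simp add: pr_less_def)
    moreover have "peq_degree S0 \<sqsubset>\<^bsub>Peq\<^esub> peq_degree R" "peq_degree S1 \<sqsubset>\<^bsub>Peq\<^esub> peq_degree R"
      using S less assms by (simp_all add: degree_less_iff)
    ultimately show ?L
      unfolding join_reducible_def using degree_in_carrier S assms by blast
  qed
qed

end

theory Submission
  imports Defs "HOL-Library.Nat_Bijection"
begin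

text \<open>
  The degree of every punctual relation \<open>R\<close> is join-reducible, and \<open>R\<^sub>Z\<close> is an instance.

  Both relations below \<open>R\<close> are pullbacks of \<open>R\<close> along primitive recursive surjections \<open>g\<^sub>0\<close> and
  \<open>g\<^sub>1\<close>, so that they are punctual and lie below \<open>R\<close> for trivial reasons. Think of an
  argument of \<open>g\<^sub>i\<close> as a pair of a stage \<open>s\<close> and a number \<open>y\<close>. The function returns \<open>y\<close> if \<open>y\<close> is
  at most a bound \<open>u\<^sub>i(s) \<le> s\<close>, and \<open>0\<close> otherwise. The stages are divided into consecutive phases
  that alternate between two sides. During a phase of side \<open>i\<close> that starts at stage \<open>t\<close>, the
  bound \<open>u\<^sub>i\<close> stays at \<open>t\<close>, while the bound of the other side is \<open>s\<close> itself.

  \<^item> Strictness (\<open>not_le_pullback_delay\<close>). The phase lasts until some \<open>n\<close> that is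
    inequivalent to all of \<open>0, \<dots>, t\<close> is found, and until an amount of time has passed that
    eventually exceeds \<open>max {f 0, \<dots>, f n}\<close> for each primitive recursive \<open>f\<close>. If \<open>f\<close> reduced \<open>R\<close> to
    the pullback along \<open>g\<^sub>i\<close>, then in a late phase of side \<open>i\<close> the function \<open>g\<^sub>i \<circ> f\<close> would send all
    of \<open>0, \<dots>, n\<close> into \<open>{0..t}\<close>, and hence the classes that meet \<open>{0..t}\<close> together with the class
    of \<open>n\<close> injectively into the classes that meet \<open>{0..t}\<close>.

  \<^item> Join (\<open>pullback_delay_join\<close>). At each stage \<open>x\<close> one side has bound \<open>x\<close>. A reduction of its
    pullback to \<open>T\<close> then supplies one \<open>T\<close>-class for each \<open>R\<close>-class that meets \<open>{0..x}\<close>. When \<open>x\<close> is the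
    least element of its \<open>R\<close>-class, fewer \<open>T\<close>-classes have been spent on smaller arguments, so
    a bounded search finds an unused one to which \<open>x\<close> can be sent. This is a primitive
    recursive reduction of \<open>R\<close> to \<open>T\<close>.

  What remains is a clock: a primitive recursive predicate of \<open>n\<close> and \<open>s\<close> that
  becomes true for each \<open>n\<close>, but, given a primitive recursive function of \<open>n\<close>, for all large \<open>n\<close> only at
  stages \<open>s\<close> that are not below its value. It says that a stack machine that evaluates the Ackermann function at
  \<open>(n, n)\<close> has halted after \<open>s\<close> steps: a single step is primitive recursive on codes of stacks,
  the machine needs almost as many steps as the value that it computes (\<open>halted_by_imp_ack_le\<close>), and the
  Ackermann function dominates the primitive recursive functions (\<open>prim_rec_less_ack\<close>).
\<close>

section \<open>Closure properties of the primitive recursive functions\<close>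

text \<open>
  Only the values of a function on lists of length \<open>n\<close> matter here. This makes the notion
  invariant under extensional equality on these lists, which the closure rules below rely on: with them,
  primitive recursiveness of an explicit term is proved by following its structure.
\<close>

definition pr_on :: "nat \<Rightarrow> (nat list \<Rightarrow> nat) \<Rightarrow> bool" where
  "pr_on n f \<longleftrightarrow> (\<exists>g. prim_rec n g \<and> (\<forall>xs. length xs = n \<longrightarrow> f xs = g xs))"

definition pr_pred :: "nat \<Rightarrow> (nat list \<Rightarrow> bool) \<Rightarrow> bool" where
  "pr_pred n P \<longleftrightarrow> pr_on n (\<lambda>xs. of_bool (P xs))"

named_theorems pr_intros

lemma pr_on_cong:
  assumes "pr_on n f" "\<And>xs. length xs = n \<Longrightarrow> f' xs = f xs"
  shows "pr_on n f'"
  using assms unfolding pr_on_def by metis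

lemma pr_on_comp:
  assumes f: "pr_on (length gs) f" and gs: "\<forall>g\<in>set gs. pr_on n g"
  shows "pr_on n (\<lambda>xs. f (map (\<lambda>g. g xs) gs))"
proof -
  obtain f' where f': "prim_rec (length gs) f'" "\<And>xs. length xs = length gs \<Longrightarrow> f xs = f' xs"
    using f unfolding pr_on_def by blast
  obtain c where c: "\<And>g. g \<in> set gs \<Longrightarrow> prim_rec n (c g)"
    "\<And>g xs. g \<in> set gs \<Longrightarrow> length xs = n \<Longrightarrow> g xs = c g xs"
    using gs unfolding pr_on_def by metis
  have "prim_rec n (\<lambda>xs. f' (map (\<lambda>g. g xs) (map c gs)))"
    by (rule prim_rec.comp) (use f' c in auto)
  moreover have "f (map (\<lambda>g. g xs) gs) = f' (map (\<lambda>g. g xs) (map c gs))" if "length xs = n" for xs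
  proof -
    have "map (\<lambda>g. g xs) gs = map (\<lambda>g. g xs) (map c gs)"
      using c(2) that by simp
    then show ?thesis using f'(2) by (metis length_map)
  qed
  ultimately show ?thesis unfolding pr_on_def by blast
qed

lemma pr_on_nth [pr_intros]: "i < n \<Longrightarrow> pr_on n (\<lambda>xs. xs ! i)"
  unfolding pr_on_def using prim_rec.proj by blast

lemma pr_on_Suc [pr_intros]:
  assumes "pr_on n f" shows "pr_on n (\<lambda>xs. Suc (f xs))"
proof -
  have "pr_on 1 (\<lambda>xs. Suc (xs ! 0))"
    unfolding pr_on_def using prim_rec.succ by blast
  with assms show ?thesis using pr_on_comp[of "[f]" "\<lambda>xs. Suc (xs ! 0)" n] by simp
qed

lemma pr_on_const [pr_intros]: "pr_on n (\<lambda>xs. c)"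
proof (induction c)
  case 0
  then show ?case unfolding pr_on_def using prim_rec.zero by blast
next
  case (Suc c)
  then show ?case by (rule pr_on_Suc)
qed

text \<open>
  Weakening: the step function of a recursion sees the stage and the previous value in front of
  the parameters, so that the parameters appear there as \<open>drop 2 ys\<close>.
\<close>

lemma pr_on_drop:
  assumes "pr_on n f" shows "pr_on (k + n) (\<lambda>ys. f (drop k ys))"
proof -
  let ?gs = "map (\<lambda>i ys. ys ! i) [k..<k + n] :: (nat list \<Rightarrow> nat) list"
  have "pr_on (k + n) (\<lambda>ys. f (map (\<lambda>g. g ys) ?gs))"
    by (rule pr_on_comp) (use assms pr_on_nth in auto)
  then show ?thesis
    by (rule pr_on_cong) (auto intro!: arg_cong[of _ _ f] nth_equalityI)
qed

lemma pr_on_drop2: "pr_on n f \<Longrightarrow> pr_on (Suc (Suc n)) (\<lambda>ys. f (drop 2 ys))"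
  using pr_on_drop[of n f 2] by simp

lemma pr_on_drop_nth [pr_intros]: "k + i < n \<Longrightarrow> pr_on n (\<lambda>ys. drop k ys ! i)"
  by (rule pr_on_cong[OF pr_on_nth]) auto

lemma pr_on_rec_nat:
  assumes b: "pr_on n b" and e: "pr_on n e"
    and G: "pr_on (Suc (Suc n)) (\<lambda>ys. G (ys ! 0) (ys ! 1) (drop 2 ys))"
  shows "pr_on n (\<lambda>xs. rec_nat (b xs) (\<lambda>k r. G k r xs) (e xs))"
proof -
  obtain b' where b': "prim_rec n b'" "\<And>xs. length xs = n \<Longrightarrow> b xs = b' xs"
    using b unfolding pr_on_def by blast
  obtain G' where G': "prim_rec (Suc (Suc n)) G'"
    "\<And>ys. length ys = Suc (Suc n) \<Longrightarrow> G (ys ! 0) (ys ! 1) (drop 2 ys) = G' ys"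
    using G unfolding pr_on_def by blast
  let ?rec = "\<lambda>ys. rec_nat (b' (tl ys)) (\<lambda>k r. G' (k # r # tl ys)) (hd ys)"
  let ?gs = "e # map (\<lambda>i xs. xs ! i) [0..<n]"
  have "pr_on (length ?gs) ?rec"
    unfolding pr_on_def using prim_rec.rec[OF b'(1) G'(1)] by auto
  then have "pr_on n (\<lambda>xs. ?rec (map (\<lambda>g. g xs) ?gs))"
    by (rule pr_on_comp) (use e pr_on_nth in auto)
  then show ?thesis
  proof (rule pr_on_cong)
    fix xs :: "nat list" assume len: "length xs = n"
    then have "map (\<lambda>g. g xs) ?gs = e xs # xs"
      by (auto intro!: nth_equalityI)
    moreover have "G k r xs = G' (k # r # xs)" for k r
      using G'(2)[of "k # r # xs"] len by simp
    ultimately show "rec_nat (b xs) (\<lambda>k r. G k r xs) (e xs) = ?rec (map (\<lambda>g. g xs) ?gs)"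
      using b'(2) len by simp
  qed
qed

lemma prim_rec_fun_iff: "prim_rec_fun u \<longleftrightarrow> pr_on 1 (\<lambda>xs. u (xs ! 0))"
proof
  assume "prim_rec_fun u"
  then obtain g where g: "prim_rec 1 g" "\<And>x. u x = g [x]"
    unfolding prim_rec_fun_def by blast
  have "u (xs ! 0) = g xs" if "length xs = 1" for xs
    using that g(2) by (cases xs) auto
  then show "pr_on 1 (\<lambda>xs. u (xs ! 0))"
    unfolding pr_on_def using g(1) by blast
next
  assume "pr_on 1 (\<lambda>xs. u (xs ! 0))"
  then obtain g where "prim_rec 1 g" "\<And>xs. length xs = 1 \<Longrightarrow> u (xs ! 0) = g xs"
    unfolding pr_on_def by blast
  then show "prim_rec_fun u"
    unfolding prim_rec_fun_def by (metis One_nat_def length_Cons list.size(3) nth_Cons_0)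
qed

lemma pr_on_app:
  assumes "prim_rec_fun u" "pr_on n f"
  shows "pr_on n (\<lambda>xs. u (f xs))"
  using assms pr_on_comp[of "[f]" "\<lambda>xs. u (xs ! 0)" n] by (simp add: prim_rec_fun_iff)

lemma pr_on_add [pr_intros]:
  assumes "pr_on n f" "pr_on n g" shows "pr_on n (\<lambda>xs. f xs + g xs)"
proof -
  have "a + b = rec_nat a (\<lambda>_. Suc) b" for a b :: nat by (induction b) auto
  moreover have "pr_on n (\<lambda>xs. rec_nat (f xs) (\<lambda>_. Suc) (g xs))"
    by (intro pr_on_rec_nat assms pr_intros) simp
  ultimately show ?thesis by simp
qed

lemma pr_on_diff [pr_intros]:
  assumes "pr_on n f" "pr_on n g" shows "pr_on n (\<lambda>xs. f xs - g xs)"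
proof -
  have pred: "pr_on m (\<lambda>xs. h xs - 1)" if "pr_on m h" for m h
  proof -
    have "a - 1 = rec_nat 0 (\<lambda>k _. k) a" for a :: nat by (cases a) auto
    moreover have "pr_on m (\<lambda>xs. rec_nat 0 (\<lambda>k _. k) (h xs))"
      by (intro pr_on_rec_nat that pr_intros) simp
    ultimately show ?thesis by presburger
  qed
  have diff: "a - b = rec_nat a (\<lambda>_ r. r - 1) b" for a b :: nat by (induction b) auto
  have "pr_on n (\<lambda>xs. rec_nat (f xs) (\<lambda>_ r. r - 1) (g xs))"
    by (intro pr_on_rec_nat assms pred pr_intros) simp
  then show ?thesis by (rule pr_on_cong) (rule diff)
qed

lemma pr_on_mult [pr_intros]:
  assumes "pr_on n f" "pr_on n g" shows "pr_on n (\<lambda>xs. f xs * g xs)"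
proof -
  have "a * b = rec_nat 0 (\<lambda>_ r. r + a) b" for a b :: nat by (induction b) auto
  moreover have "pr_on n (\<lambda>xs. rec_nat 0 (\<lambda>_ r. r + f xs) (g xs))"
    by (intro pr_on_rec_nat assms pr_intros pr_on_drop2) simp
  ultimately show ?thesis by simp
qed

lemma pr_on_power [pr_intros]:
  assumes "pr_on n f" "pr_on n g" shows "pr_on n (\<lambda>xs. f xs ^ g xs)"
proof -
  have "a ^ b = rec_nat 1 (\<lambda>_ r. a * r) b" for a b :: nat by (induction b) auto
  moreover have "pr_on n (\<lambda>xs. rec_nat 1 (\<lambda>_ r. f xs * r) (g xs))"
    by (intro pr_on_rec_nat assms pr_intros pr_on_drop2) simp
  ultimately show ?thesis by simp
qed

lemma pr_pred_not [pr_intros]: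
  assumes "pr_pred n P" shows "pr_pred n (\<lambda>xs. \<not> P xs)"
proof -
  have "pr_on n (\<lambda>xs. 1 - of_bool (P xs))"
    using assms unfolding pr_pred_def by (intro pr_intros)
  then show ?thesis
    unfolding pr_pred_def by (rule pr_on_cong) simp
qed

lemma pr_pred_conj [pr_intros]:
  assumes "pr_pred n P" "pr_pred n Q" shows "pr_pred n (\<lambda>xs. P xs \<and> Q xs)"
proof -
  have "pr_on n (\<lambda>xs. of_bool (P xs) * of_bool (Q xs))"
    using assms unfolding pr_pred_def by (intro pr_intros)
  then show ?thesis
    unfolding pr_pred_def by (rule pr_on_cong) simp
qed

lemma pr_pred_less [pr_intros]:
  assumes "pr_on n f" "pr_on n g" shows "pr_pred n (\<lambda>xs. f xs < g xs)"
proof -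
  have "pr_on n (\<lambda>xs. 1 - (1 - (g xs - f xs)))"
    by (intro assms pr_intros)
  then show ?thesis
    unfolding pr_pred_def by (rule pr_on_cong) auto
qed

lemma pr_pred_le [pr_intros]:
  assumes "pr_on n f" "pr_on n g" shows "pr_pred n (\<lambda>xs. f xs \<le> g xs)"
  using pr_pred_not[OF pr_pred_less[OF assms(2,1)]] by (simp add: not_less)

lemma pr_pred_eq [pr_intros]:
  assumes "pr_on n f" "pr_on n g" shows "pr_pred n (\<lambda>xs. f xs = g xs)"
  using pr_pred_conj[OF pr_pred_le[OF assms] pr_pred_le[OF assms(2,1)]] by (simp add: eq_iff)

lemma pr_on_if [pr_intros]:
  assumes "pr_pred n P" "pr_on n f" "pr_on n g"
  shows "pr_on n (\<lambda>xs. if P xs then f xs else g xs)"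
proof -
  have "pr_on n (\<lambda>xs. of_bool (P xs) * f xs + (1 - of_bool (P xs)) * g xs)"
    using assms unfolding pr_pred_def by (intro pr_intros)
  then show ?thesis by (rule pr_on_cong) simp
qed

text \<open>
  The disjunct \<open>k = b\<close> bounds the search: without a smaller witness the result is \<open>b\<close>.
\<close>

lemma bounded_least_eq_rec:
  "(LEAST k. k = b \<or> P k) = rec_nat 0 (\<lambda>_ r. if P r then r else Suc r) b"
proof -
  let ?r = "rec_nat 0 (\<lambda>_ r. if P r then r else Suc r)"
  have "?r b \<le> b \<and> (\<forall>j<?r b. \<not> P j) \<and> (?r b < b \<longrightarrow> P (?r b))"
    by (induction b) (auto simp: less_Suc_eq le_Suc_eq)
  then show ?thesis
    by (intro Least_equality) (auto simp: not_le intro: ccontr)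
qed

lemma pr_on_least [pr_intros]:
  assumes e: "pr_on n e" and P: "pr_pred (Suc n) (\<lambda>ys. P (ys ! 0) (drop 1 ys))"
  shows "pr_on n (\<lambda>xs. LEAST k. k = e xs \<or> P k xs)"
proof -
  have "pr_pred (Suc (Suc n)) (\<lambda>ys. P (ys ! 1) (drop 2 ys))"
    using pr_on_drop[OF P[unfolded pr_pred_def], of 1] unfolding pr_pred_def
    by (auto elim!: pr_on_cong simp: numeral_2_eq_2)
  then have "pr_on n (\<lambda>xs. rec_nat 0 (\<lambda>_ r. if P r xs then r else Suc r) (e xs))"
    by (intro pr_on_rec_nat e pr_intros) auto
  then show ?thesis by (simp add: bounded_least_eq_rec)
qed

lemma pr_pred_bex [pr_intros]:
  assumes e: "pr_on n e" and P: "pr_pred (Suc n) (\<lambda>ys. P (ys ! 0) (drop 1 ys))"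
  shows "pr_pred n (\<lambda>xs. \<exists>k\<le>e xs. P k xs)"
proof -
  have "(\<exists>k\<le>b. Q k) \<longleftrightarrow> (LEAST k. k = Suc b \<or> Q k) \<le> b" for b :: nat and Q
  proof
    assume "\<exists>k\<le>b. Q k"
    then obtain k where "k \<le> b" "Q k" by blast
    then show "(LEAST k. k = Suc b \<or> Q k) \<le> b"
      using Least_le[of "\<lambda>k. k = Suc b \<or> Q k" k] by simp
  next
    assume "(LEAST k. k = Suc b \<or> Q k) \<le> b"
    moreover have "(LEAST k. k = Suc b \<or> Q k) = Suc b \<or> Q (LEAST k. k = Suc b \<or> Q k)"
      by (rule LeastI[of _ "Suc b"]) simp
    ultimately show "\<exists>k\<le>b. Q k" by (metis Suc_n_not_le_n)
  qed
  moreover have "pr_pred n (\<lambda>xs. (LEAST k. k = Suc (e xs) \<or> P k xs) \<le> e xs)"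
    by (intro pr_pred_le pr_on_least pr_on_Suc e P)
  ultimately show ?thesis by simp
qed

lemma pr_on_drop1: "pr_on n f \<Longrightarrow> pr_on (Suc n) (\<lambda>ys. f (drop 1 ys))"
  using pr_on_drop[of n f 1] by simp

lemma pr_on_div [pr_intros]:
  assumes "pr_on n f" "pr_on n g"
  shows "pr_on n (\<lambda>xs. f xs div g xs)"
proof -
  have div: "a div b = (if b = 0 then 0 else LEAST q. q = a \<or> a < Suc q * b)" for a b :: nat
  proof (cases "b = 0")
    case False
    have "a div b \<le> q" if "q = a \<or> a < Suc q * b" for q
      using that False by (metis div_le_dividend less_Suc_eq_le less_mult_imp_div_less)
    moreover have "a < Suc (a div b) * b"
      using False dividend_less_div_times[of b a] by simp
    ultimately have "(LEAST q. q = a \<or> a < Suc q * b) = a div b"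
      by (intro Least_equality) simp_all
    then show ?thesis using False by simp
  qed simp
  have "pr_on n (\<lambda>xs. if g xs = 0 then 0 else LEAST q. q = f xs \<or> f xs < Suc q * g xs)"
    by (intro assms pr_intros pr_on_drop1) simp
  then show ?thesis by (rule pr_on_cong) (rule div)
qed

lemma pr_pred_odd [pr_intros]:
  assumes "pr_on n f" shows "pr_pred n (\<lambda>xs. odd (f xs))"
proof -
  have "odd a \<longleftrightarrow> a = Suc (2 * (a div 2))" for a :: nat by presburger
  moreover have "pr_pred n (\<lambda>xs. f xs = Suc (2 * (f xs div 2)))"
    by (intro assms pr_intros)
  ultimately show ?thesis by simp
qed

section \<open>The Ackermann function dominates the primitive recursive functions\<close>

fun ack :: "nat \<Rightarrow> nat \<Rightarrow> nat" where
  "ack 0 n = Suc n"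
| "ack (Suc m) 0 = ack m 1"
| "ack (Suc m) (Suc n) = ack m (ack (Suc m) n)"

lemma ack_greater: "n < ack m n"
  by (induction m n rule: ack.induct) auto

lemma ack_strict_mono: "strict_mono (ack m)"
proof -
  have "ack m n < ack m (Suc n)" for n
    by (cases m) (auto simp: ack_greater)
  then show ?thesis by (simp add: strict_mono_Suc_iff)
qed

lemma ack_mono: "n \<le> n' \<Longrightarrow> ack m n \<le> ack m n'"
  using ack_strict_mono by (simp add: strict_mono_less_eq)

lemma ack_Suc_le: "ack m (Suc n) \<le> ack (Suc m) n"
proof (induction n)
  case (Suc n)
  have "Suc (Suc n) \<le> ack m (Suc n)" using ack_greater[of "Suc n" m] by simp
  then show ?case using Suc by (auto intro: ack_mono order_trans)
qed simp

lemma ack_mono_level: "m \<le> m' \<Longrightarrow> ack m n \<le> ack m' n"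
proof (induction m' rule: dec_induct)
  case (step k)
  have "ack k n \<le> ack k (Suc n)" by (simp add: ack_mono)
  also have "\<dots> \<le> ack (Suc k) n" by (rule ack_Suc_le)
  finally show ?case using step by simp
qed simp

text \<open>
  One level above \<open>i\<close> and \<open>j\<close> the defining equation \<open>ack (Suc m) (Suc n) = ack m (ack (Suc m) n)\<close>
  absorbs the outer application, and a second level absorbs the successor in the argument.
\<close>

lemma ack_comp_less: "ack i (ack j n) < ack (Suc (Suc (i + j))) n"
proof -
  have "ack i (ack j n) \<le> ack (i + j) (ack j n)" by (rule ack_mono_level) simp
  also have "\<dots> < ack (i + j) (ack (Suc (i + j)) n)"
  proof -
    have "ack j n < ack j (Suc n)" using ack_strict_mono by (simp add: strict_mono_less)
    also have "\<dots> \<le> ack (Suc j) n" by (rule ack_Suc_le)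
    also have "\<dots> \<le> ack (Suc (i + j)) n" by (rule ack_mono_level) simp
    finally show ?thesis using ack_strict_mono by (simp add: strict_mono_less)
  qed
  also have "\<dots> = ack (Suc (i + j)) (Suc n)" by simp
  also have "\<dots> \<le> ack (Suc (Suc (i + j))) n" by (rule ack_Suc_le)
  finally show ?thesis .
qed

lemma ack_add_less: "ack i n + ack j n < ack (i + j + 4) n"
proof -
  have ack1: "ack (Suc 0) k = k + 2" for k by (induction k) auto
  have ack2: "ack 2 k = 2 * k + 3" for k
    unfolding numeral_2_eq_2 by (induction k) (auto simp: ack1)
  have "ack i n \<le> ack (i + j) n" "ack j n \<le> ack (i + j) n"
    by (rule ack_mono_level; simp)+
  then have "ack i n + ack j n \<le> ack 2 (ack (i + j) n)" by (simp add: ack2)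
  also have "\<dots> < ack (Suc (Suc (2 + (i + j)))) n" by (rule ack_comp_less)
  finally show ?thesis by (simp add: numeral_eq_Suc)
qed

text \<open>
  Composition raises the level by the two preceding lemmas. For primitive recursion, one level \<open>J\<close> bounds the
  step function, and by induction on the recursion variable \<open>l\<close> level \<open>Suc J\<close> bounds the value: each
  stage costs one application of \<open>ack J\<close>, which is what increasing the argument of \<open>ack (Suc J)\<close> by one
  provides.
\<close>

lemma prim_rec_less_ack:
  assumes "prim_rec n f"
  shows "\<exists>k. \<forall>xs. length xs = n \<longrightarrow> f xs < ack k (sum_list xs)"
  using assms
proof (induction rule: prim_rec.induct)
  case (zero n)
  have "0 < ack 0 s" for s by simp
  then show ?case by blast
next
  case succ
  have "Suc (xs ! 0) < ack (Suc 0) (sum_list xs)" if "length xs = 1" for xs :: "nat list"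
  proof -
    have "ack (Suc 0) k = k + 2" for k by (induction k) auto
    then show ?thesis using that by (cases xs) auto
  qed
  then show ?case by blast
next
  case (proj i n)
  have "xs ! i < ack 0 (sum_list xs)" if "length xs = n" for xs :: "nat list"
    using that proj elem_le_sum_list[of i xs] by auto
  then show ?case by blast
next
  case (comp gs f n)
  obtain i where i: "\<And>xs. length xs = length gs \<Longrightarrow> f xs < ack i (sum_list xs)"
    using comp.IH(1) by blast
  have "\<exists>j. \<forall>xs. length xs = n \<longrightarrow> (\<Sum>g\<leftarrow>gs. g xs) < ack j (sum_list xs)"
    using comp.IH(2)
  proof (induction gs)
    case Nil
    have "(\<Sum>g\<leftarrow>[]. g xs) < ack 0 (sum_list xs)" for xs :: "nat list" by simp
    then show ?case by blast
  next
    case (Cons g gs)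
    then obtain j k where j: "\<And>xs. length xs = n \<Longrightarrow> (\<Sum>g\<leftarrow>gs. g xs) < ack j (sum_list xs)"
      and k: "\<And>xs. length xs = n \<Longrightarrow> g xs < ack k (sum_list xs)" by auto
    have "(\<Sum>g\<leftarrow>g # gs. g xs) < ack (k + j + 4) (sum_list xs)" if "length xs = n" for xs
      using j[OF that] k[OF that] ack_add_less[of k "sum_list xs" j] by simp
    then show ?case by blast
  qed
  then obtain j where j: "\<And>xs. length xs = n \<Longrightarrow> (\<Sum>g\<leftarrow>gs. g xs) < ack j (sum_list xs)" by blast
  have "f (map (\<lambda>g. g xs) gs) < ack (Suc (Suc (i + j))) (sum_list xs)" if "length xs = n" for xs
  proof -
    have "f (map (\<lambda>g. g xs) gs) < ack i (\<Sum>g\<leftarrow>gs. g xs)" using i by simp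
    also have "\<dots> \<le> ack i (ack j (sum_list xs))" using j[OF that] by (simp add: ack_mono)
    also have "\<dots> < ack (Suc (Suc (i + j))) (sum_list xs)" by (rule ack_comp_less)
    finally show ?thesis .
  qed
  then show ?case by blast
next
  case (rec n f g)
  obtain i where i: "\<And>xs. length xs = n \<Longrightarrow> f xs < ack i (sum_list xs)"
    using rec.IH(1) by blast
  obtain j where j: "\<And>xs. length xs = Suc (Suc n) \<Longrightarrow> g xs < ack j (sum_list xs)"
    using rec.IH(2) by blast
  define J where "J = i + j + 4"
  have J: "ack i s + s < ack J s" "ack j s + s < ack J s" for s
  proof -
    have "ack (i + j) s + ack 0 s < ack J s"
      using ack_add_less[of "i + j" s 0] by (simp add: J_def)
    moreover have "ack i s \<le> ack (i + j) s" "ack j s \<le> ack (i + j) s"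
      by (rule ack_mono_level; simp)+
    ultimately show "ack i s + s < ack J s" "ack j s + s < ack J s" by simp_all
  qed
  define r where "r xs = rec_nat (f xs) (\<lambda>k r. g (k # r # xs))" for xs
  \<comment> \<open>The summands besides the value keep track of the whole argument list of \<open>g\<close>, so that its sum
      is again below the bound.\<close>
  have r: "r xs l + (l + sum_list xs) < ack (Suc J) (l + sum_list xs)" if "length xs = n" for xs l
  proof (induction l)
    case 0
    have "f xs + sum_list xs < ack J (sum_list xs)"
      using i[OF that] J(1)[of "sum_list xs"] by simp
    also have "\<dots> \<le> ack (Suc J) (sum_list xs)" by (rule ack_mono_level) simp
    finally show ?case by (simp add: r_def)
  next
    case (Suc l)
    let ?s = "l + (r xs l + sum_list xs)"
    have "g (l # r xs l # xs) < ack j ?s"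
      using j[of "l # r xs l # xs"] that by simp
    then have "r xs (Suc l) + (Suc l + sum_list xs) < ack J ?s"
      using J(2)[of ?s] by (simp add: r_def)
    also have "\<dots> \<le> ack J (ack (Suc J) (l + sum_list xs))"
      using Suc by (intro ack_mono) simp
    also have "\<dots> = ack (Suc J) (Suc l + sum_list xs)" by simp
    finally show ?case .
  qed
  have "rec_nat (f (tl xs)) (\<lambda>k r. g (k # r # tl xs)) (hd xs) < ack (Suc J) (sum_list xs)"
    if "length xs = Suc n" for xs
    using r[of "tl xs" "hd xs"] that by (cases xs) (auto simp: r_def)
  then show ?case by blast
qed

section \<open>A primitive recursive clock\<close>

text \<open>
  A stack of numbers is coded by a number: \<open>0\<close> is the empty stack, and every positive number is
  \<open>push x m\<close> for exactly one \<open>x\<close> and \<open>m\<close>. The same coding serves as a pairing function further below.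
\<close>

definition push :: "nat \<Rightarrow> nat \<Rightarrow> nat" where
  "push x m = 2 ^ m * Suc (2 * x)"

definition top_of :: "nat \<Rightarrow> nat" where
  "top_of w = (LEAST m. m = w \<or> odd (w div 2 ^ m))"

definition pop :: "nat \<Rightarrow> nat" where
  "pop w = w div 2 ^ Suc (top_of w)"

lemma top_of_push [simp]: "top_of (push x m) = m"
  unfolding top_of_def
proof (rule Least_equality)
  show "m = push x m \<or> odd (push x m div 2 ^ m)" by (simp add: push_def)
next
  fix j assume j: "j = push x m \<or> odd (push x m div 2 ^ j)"
  show "m \<le> j"
  proof (rule ccontr)
    assume "\<not> m \<le> j"
    then have m: "m = j + Suc (m - Suc j)" by simp
    have "push x m = 2 ^ j * (2 * (2 ^ (m - Suc j) * Suc (2 * x)))"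
      unfolding push_def by (subst m, subst power_add) (simp add: algebra_simps)
    then have "even (push x m div 2 ^ j)" by simp
    moreover have "j < push x m"
    proof -
      have "j < 2 ^ m" using \<open>\<not> m \<le> j\<close> less_exp[of m] by linarith
      also have "\<dots> \<le> push x m" by (simp add: push_def)
      finally show ?thesis .
    qed
    ultimately show False using j by simp
  qed
qed

lemma pop_push [simp]: "pop (push x m) = x"
proof -
  have "push x m div 2 ^ Suc m = Suc (2 * x) div 2"
    unfolding push_def power_Suc2 by (subst div_mult2_eq) simp
  then show ?thesis by (simp add: pop_def)
qed

lemma push_neq_0 [simp]: "push x m \<noteq> 0"
  by (simp add: push_def)

lemma pop_le: "pop w \<le> w"
  by (simp add: pop_def)

lemma pr_on_push [pr_intros]:
  "pr_on n f \<Longrightarrow> pr_on n g \<Longrightarrow> pr_on n (\<lambda>xs. push (f xs) (g xs))"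
  unfolding push_def by (intro pr_intros)

lemma pr_on_top_of [pr_intros]: "pr_on n f \<Longrightarrow> pr_on n (\<lambda>xs. top_of (f xs))"
proof -
  have "pr_on n (\<lambda>xs. LEAST m. m = f xs \<or> odd (f xs div 2 ^ m))" if "pr_on n f" for f
    by (intro that pr_intros pr_on_drop1) simp
  then show "pr_on n f \<Longrightarrow> pr_on n (\<lambda>xs. top_of (f xs))" by (simp add: top_of_def)
qed

lemma pr_on_pop [pr_intros]: "pr_on n f \<Longrightarrow> pr_on n (\<lambda>xs. pop (f xs))"
  unfolding pop_def by (intro pr_intros)

text \<open>
  A stack with \<open>n\<close> on top and \<open>m\<close> below it stands for the pending evaluation of \<open>ack m n\<close>, whose value is to
  replace these two entries. The three cases are the defining equations of \<open>ack\<close>; a stack with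
  a single entry is a final state.
\<close>

definition ack_step :: "nat \<Rightarrow> nat" where
  "ack_step w =
    (let n = top_of w; x = pop w; m = top_of x; y = pop x in
      if x = 0 then w
      else if m = 0 then push y (Suc n)
      else if n = 0 then push (push y (m - 1)) 1
      else push (push (push y (m - 1)) m) (n - 1))"

definition ack_run :: "nat \<Rightarrow> nat \<Rightarrow> nat" where
  "ack_run w s = (ack_step ^^ s) w"

lemma pr_on_ack_run [pr_intros]:
  assumes "pr_on n f" "pr_on n g"
  shows "pr_on n (\<lambda>xs. ack_run (f xs) (g xs))"
proof -
  have run: "ack_run w s = rec_nat w (\<lambda>_. ack_step) s" for w s
    unfolding ack_run_def by (induction s) auto
  have "pr_on n (\<lambda>xs. rec_nat (f xs) (\<lambda>_. ack_step) (g xs))"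
    unfolding ack_step_def Let_def
    by (intro pr_on_rec_nat assms pr_intros) simp_all
  then show ?thesis by (simp only: run)
qed

lemma ack_run_add: "ack_run w (s + s') = ack_run (ack_run w s) s'"
  by (simp add: ack_run_def funpow_add add.commute[of s])

text \<open>
  The rest \<open>x\<close> of the stack is arbitrary because an inner call is evaluated on top of the pending outer one.
\<close>

lemma ack_run_eval: "\<exists>s. ack_run (push (push x m) n) s = push x (ack m n)"
proof (induction m n arbitrary: x rule: ack.induct)
  case (1 n)
  have "ack_run (push (push x 0) n) 1 = push x (ack 0 n)"
    by (simp add: ack_run_def ack_step_def Let_def)
  then show ?case by blast
next
  case (2 m)
  obtain s where s: "ack_run (push (push x m) 1) s = push x (ack m 1)" using "2.IH" by blast
  have "ack_run (push (push x (Suc m)) 0) 1 = push (push x m) 1"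
    by (simp add: ack_run_def ack_step_def Let_def)
  then have "ack_run (push (push x (Suc m)) 0) (1 + s) = push x (ack (Suc m) 0)"
    by (simp only: ack_run_add s ack.simps)
  then show ?case by blast
next
  case (3 m n)
  obtain s where s: "ack_run (push (push (push x m) (Suc m)) n) s = push (push x m) (ack (Suc m) n)"
    using "3.IH"(1) by blast
  obtain s' where s': "ack_run (push (push x m) (ack (Suc m) n)) s' = push x (ack m (ack (Suc m) n))"
    using "3.IH"(2) by blast
  have "ack_run (push (push x (Suc m)) (Suc n)) 1 = push (push (push x m) (Suc m)) n"
    by (simp add: ack_run_def ack_step_def Let_def)
  then have "ack_run (push (push x (Suc m)) (Suc n)) (1 + s + s') = push x (ack (Suc m) (Suc n))"
    by (simp only: ack_run_add s s' ack.simps)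
  then show ?case by blast
qed

text \<open>
  A step increases the top entry by at most one, so that a large result requires a long computation.
\<close>

lemma top_of_ack_run_le: "top_of (ack_run w s) \<le> top_of w + s"
proof (induction s)
  case (Suc s)
  have "top_of (ack_step v) \<le> Suc (top_of v)" for v
    by (auto simp: ack_step_def Let_def)
  then have "top_of (ack_run w (Suc s)) \<le> Suc (top_of (ack_run w s))"
    by (simp add: ack_run_def)
  then show ?case using Suc by simp
qed (simp add: ack_run_def)

lemma ack_run_halted:
  assumes "pop w = 0" shows "ack_run w s = w"
  using assms unfolding ack_run_def
  by (induction s) (simp_all add: ack_step_def)

text \<open>
  The clock: \<open>pop w = 0\<close> says that the stack \<open>w\<close> has at most one entry.
\<close>

definition halted_by :: "nat \<Rightarrow> nat \<Rightarrow> bool" where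
  "halted_by n s \<longleftrightarrow> pop (ack_run (push (push 0 n) n) s) = 0"

lemma pr_pred_halted_by [pr_intros]:
  "pr_on n f \<Longrightarrow> pr_on n g \<Longrightarrow> pr_pred n (\<lambda>xs. halted_by (f xs) (g xs))"
  unfolding halted_by_def by (intro pr_intros)

lemma halted_by_mono: "halted_by n s \<Longrightarrow> s \<le> s' \<Longrightarrow> halted_by n s'"
  unfolding halted_by_def by (metis ack_run_add ack_run_halted le_add_diff_inverse)

lemma halted_by_exists: "\<exists>s. halted_by n s"
  unfolding halted_by_def by (metis ack_run_eval pop_push)

text \<open>
  Final states are fixed by the machine, so whenever it has halted its top entry is the value \<open>ack n n\<close>;
  starting from \<open>n\<close>, the top entry has reached at most \<open>n + s\<close>.
\<close>

lemma halted_by_imp_ack_le: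
  assumes "halted_by n s" shows "ack n n \<le> n + s"
proof -
  let ?w = "push (push 0 n) n"
  obtain s0 where s0: "ack_run ?w s0 = push 0 (ack n n)" using ack_run_eval by blast
  then have "ack_run ?w (s0 + s) = push 0 (ack n n)"
    by (simp add: ack_run_add ack_run_halted)
  moreover have "ack_run ?w (s + s0) = ack_run ?w s"
    using assms by (simp add: ack_run_add ack_run_halted halted_by_def)
  ultimately have "ack_run ?w s = push 0 (ack n n)" by (simp add: add.commute)
  then show ?thesis using top_of_ack_run_le[of ?w s] by simp
qed

text \<open>
  A fixed level \<open>k\<close> of the Ackermann function bounds \<open>f\<close>, and \<open>ack n n\<close> exceeds \<open>ack k n\<close>
  by more than \<open>n\<close> as soon as \<open>n \<ge> k + 4\<close>.
\<close>

lemma halted_by_dominates: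
  assumes "prim_rec_fun f"
  shows "\<exists>N. \<forall>n\<ge>N. \<forall>s. halted_by n s \<longrightarrow> (\<forall>x\<le>n. f x \<le> s)"
proof -
  obtain g where g: "prim_rec 1 g" "\<And>x. f x = g [x]"
    using assms unfolding prim_rec_fun_def by blast
  obtain k where k: "\<And>xs. length xs = 1 \<Longrightarrow> g xs < ack k (sum_list xs)"
    using prim_rec_less_ack[OF g(1)] by blast
  have "f x \<le> s" if "k + 4 \<le> n" "halted_by n s" "x \<le> n" for n s x
  proof -
    have "f x < ack k x" using k[of "[x]"] g(2) by simp
    moreover have "ack k x \<le> ack k n" using that(3) by (rule ack_mono)
    moreover have "ack k n + ack 0 n < ack (k + 4) n" using ack_add_less[of k n 0] by simp
    moreover have "ack (k + 4) n \<le> ack n n" using that(1) by (rule ack_mono_level)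
    moreover have "ack n n \<le> n + s" using that(2) by (rule halted_by_imp_ack_le)
    ultimately show ?thesis by simp
  qed
  then show ?thesis by blast
qed

section \<open>Least representatives and pullbacks\<close>

text \<open>
  Passing to least representatives turns equivalence of \<open>x\<close> and \<open>y\<close> into equality of two primitive recursive
  values.
\<close>

definition least_rep :: "(nat \<times> nat) set \<Rightarrow> nat \<Rightarrow> nat" where
  "least_rep R x = (LEAST j. (j, x) \<in> R)"

context
  fixes R :: "(nat \<times> nat) set"
  assumes R: "punctual R"
begin

lemma punctual_equiv: "equiv UNIV R"
  using R by (simp add: punctual_def)

lemma punctual_refl: "(x, x) \<in> R"
  using punctual_equiv by (auto simp: equiv_def refl_on_def)

lemma least_rep_in: "(least_rep R x, x) \<in> R"
  unfolding least_rep_def by (rule LeastI) (rule punctual_refl)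

lemma least_rep_le: "least_rep R x \<le> x"
  unfolding least_rep_def by (rule Least_le) (rule punctual_refl)

lemma least_rep_eq_iff: "least_rep R x = least_rep R y \<longleftrightarrow> (x, y) \<in> R"
proof
  assume "least_rep R x = least_rep R y"
  then show "(x, y) \<in> R"
    using least_rep_in punctual_equiv by (metis equivE symD transD)
next
  assume "(x, y) \<in> R"
  then have "(j, x) \<in> R \<longleftrightarrow> (j, y) \<in> R" for j
    using punctual_equiv by (metis equivE symD transD)
  then show "least_rep R x = least_rep R y" by (simp add: least_rep_def)
qed

lemma least_rep_idem: "least_rep R (least_rep R x) = least_rep R x"
  by (simp only: least_rep_eq_iff least_rep_in)

lemma prim_rec_least_rep: "prim_rec_fun (least_rep R)"
proof -
  obtain c where c: "prim_rec 2 c" "\<And>x y. c [x, y] = of_bool ((x, y) \<in> R)"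
    using R unfolding punctual_def prim_rec_rel_def by (auto simp: of_bool_def)
  have "pr_on 2 (\<lambda>ys. of_bool ((ys ! 0, ys ! 1) \<in> R))"
    unfolding pr_on_def
  proof (intro exI conjI allI impI)
    show "prim_rec 2 c" by (rule c)
    show "of_bool ((ys ! 0, ys ! 1) \<in> R) = c ys" if "length ys = 2" for ys
      using that c(2)[of "ys ! 0" "ys ! 1"] by (cases ys; cases "tl ys") auto
  qed
  then have "pr_pred (Suc 1) (\<lambda>ys. (ys ! 0, drop 1 ys ! 0) \<in> R)"
    unfolding pr_pred_def by (auto elim!: pr_on_cong simp: numeral_2_eq_2)
  then have "pr_on 1 (\<lambda>xs. LEAST j. j = xs ! 0 \<or> (j, xs ! 0) \<in> R)"
    by (intro pr_on_least pr_intros) simp_all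
  moreover have "least_rep R x = (LEAST j. j = x \<or> (j, x) \<in> R)" for x
    unfolding least_rep_def by (rule arg_cong[of _ _ Least]) (auto simp: punctual_refl)
  ultimately show ?thesis by (simp add: prim_rec_fun_iff)
qed

lemma least_rep_unbounded: "\<exists>n. t < least_rep R n"
proof (rule ccontr)
  assume "\<nexists>n. t < least_rep R n"
  then have le: "least_rep R n \<le> t" for n by (simp add: not_less)
  have "UNIV // R \<subseteq> (\<lambda>i. R `` {i}) ` {..t}"
  proof
    fix X assume "X \<in> UNIV // R"
    then obtain x where "X = R `` {x}" by (auto elim: quotientE)
    then have "X = R `` {least_rep R x}"
      using equiv_class_eq[OF punctual_equiv least_rep_in] by simp
    then show "X \<in> (\<lambda>i. R `` {i}) ` {..t}" using le by blast
  qed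
  then have "finite (UNIV // R)" by (rule finite_subset) simp
  then show False using R by (simp add: punctual_def)
qed

end

lemmas pr_on_least_rep = pr_on_app[OF prim_rec_least_rep]

definition pullback :: "(nat \<Rightarrow> nat) \<Rightarrow> (nat \<times> nat) set \<Rightarrow> (nat \<times> nat) set" where
  "pullback g R = {(x, y). (g x, g y) \<in> R}"

lemma pullback_le: "prim_rec_fun g \<Longrightarrow> pullback g R \<le>pr R"
  unfolding pr_le_def pullback_def by blast

text \<open>
  The function \<open>g\<close> maps each class of the pullback onto a class of \<open>R\<close>, and by surjectivity every
  class of \<open>R\<close> arises in this way.
\<close>

lemma punctual_pullback:
  assumes R: "punctual R" and g: "prim_rec_fun g" "surj g"
  shows "punctual (pullback g R)"
  unfolding punctual_def
proof (intro conjI)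
  show "equiv UNIV (pullback g R)"
    unfolding pullback_def least_rep_eq_iff[OF R, symmetric]
    by (auto simp: equiv_def refl_on_def sym_def trans_def)
next
  have "pr_pred 2 (\<lambda>xs. least_rep R (g (xs ! 0)) = least_rep R (g (xs ! 1)))"
    by (intro pr_pred_eq pr_on_least_rep[OF R] pr_on_app[OF g(1)] pr_intros) simp_all
  then have "pr_on 2 (\<lambda>xs. of_bool ((g (xs ! 0), g (xs ! 1)) \<in> R))"
    by (simp add: pr_pred_def least_rep_eq_iff[OF R])
  then obtain c where "prim_rec 2 c"
    "\<And>xs. length xs = 2 \<Longrightarrow> of_bool ((g (xs ! 0), g (xs ! 1)) \<in> R) = c xs"
    unfolding pr_on_def by blast
  moreover from this(2)[of "[x, y]" for x y]
  have "c [x, y] = (if (x, y) \<in> pullback g R then 1 else 0)" for x y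
    by (auto simp: pullback_def of_bool_def)
  ultimately show "prim_rec_rel (pullback g R)"
    unfolding prim_rec_rel_def by blast
next
  have img: "R `` {g x} = g ` (pullback g R `` {x})" for x
    using g(2) by (force simp: pullback_def surj_def)
  have sub: "UNIV // R \<subseteq> (`) g ` (UNIV // pullback g R)"
  proof
    fix X assume "X \<in> UNIV // R"
    then obtain z where "X = R `` {z}" by (rule quotientE)
    moreover obtain x where "z = g x" using g(2) by (rule surjE)
    ultimately have "X = g ` (pullback g R `` {x})" by (simp add: img)
    then show "X \<in> (`) g ` (UNIV // pullback g R)" by (simp add: quotientI)
  qed
  show "infinite (UNIV // pullback g R)"
  proof
    assume "finite (UNIV // pullback g R)"
    then have "finite (UNIV // R)" using sub by (rule finite_surj)
    then show False using R by (simp add: punctual_def)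
  qed
qed

section \<open>Two alternating delayed copies of a relation\<close>

text \<open>
  \<open>phase_start \<rho> s\<close> is the first stage of the phase that contains \<open>s\<close>. A phase that started at \<open>t\<close> ends at
  the first stage \<open>s\<close> at which the clock of some \<open>n \<le> s\<close> that is inequivalent to all of
  \<open>0, \<dots>, t\<close> has halted; for \<open>\<rho> = least_rep R\<close> this inequivalence is \<open>t < \<rho> n\<close>.
\<close>

primrec phase_start :: "(nat \<Rightarrow> nat) \<Rightarrow> nat \<Rightarrow> nat" where
  "phase_start \<rho> 0 = 0"
| "phase_start \<rho> (Suc s) =
    (if \<exists>n\<le>s. halted_by n s \<and> phase_start \<rho> s < \<rho> n then Suc s else phase_start \<rho> s)"

primrec phase :: "(nat \<Rightarrow> nat) \<Rightarrow> nat \<Rightarrow> nat" where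
  "phase \<rho> 0 = 0"
| "phase \<rho> (Suc s) = (if phase_start \<rho> (Suc s) = Suc s then Suc (phase \<rho> s) else phase \<rho> s)"

lemma prim_rec_phase_start:
  assumes "prim_rec_fun \<rho>" shows "prim_rec_fun (phase_start \<rho>)"
proof -
  have eq: "phase_start \<rho> s =
      rec_nat 0 (\<lambda>s t. if \<exists>n\<le>s. halted_by n s \<and> t < \<rho> n then Suc s else t) s" for s
    by (induction s) (simp_all only: phase_start.simps old.nat.rec)
  have "pr_on 1 (\<lambda>xs. rec_nat 0
      (\<lambda>s t. if \<exists>n\<le>s. halted_by n s \<and> t < \<rho> n then Suc s else t) (xs ! 0))"
    by (intro pr_on_rec_nat pr_intros pr_on_app[OF assms] pr_on_drop1) simp_all
  then show ?thesis by (simp only: prim_rec_fun_iff eq)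
qed

lemma prim_rec_phase:
  assumes "prim_rec_fun \<rho>" shows "prim_rec_fun (phase \<rho>)"
proof -
  have eq: "phase \<rho> s =
      rec_nat 0 (\<lambda>s p. if phase_start \<rho> (Suc s) = Suc s then Suc p else p) s" for s
    by (induction s) simp_all
  have "pr_on 1 (\<lambda>xs. rec_nat 0
      (\<lambda>s p. if phase_start \<rho> (Suc s) = Suc s then Suc p else p) (xs ! 0))"
    by (intro pr_on_rec_nat pr_intros pr_on_app[OF prim_rec_phase_start[OF assms]]) simp_all
  then show ?thesis by (simp only: prim_rec_fun_iff eq)
qed

text \<open>
  Every phase ends: an \<open>n\<close> with \<open>t0 < \<rho> n\<close> exists, and its clock halts and stays halted. The stage \<open>s1\<close> is the last
  one of the phase.
\<close>

lemma phase_interval: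
  assumes unb: "\<And>t. \<exists>n. t < \<rho> n" and t0: "phase_start \<rho> t0 = t0"
  obtains s1 n where "t0 \<le> s1" "\<And>s. t0 \<le> s \<Longrightarrow> s \<le> s1 \<Longrightarrow> phase_start \<rho> s = t0 \<and> phase \<rho> s = phase \<rho> t0"
    "n \<le> s1" "halted_by n s1" "t0 < \<rho> n"
proof -
  let ?end = "\<lambda>s. t0 \<le> s \<and> (\<exists>n\<le>s. halted_by n s \<and> t0 < \<rho> n)"
  define s1 where "s1 = (LEAST s. ?end s)"
  obtain n where n: "t0 < \<rho> n" using unb by blast
  obtain s where "halted_by n s" using halted_by_exists by blast
  then have "halted_by n (t0 + n + s)" by (rule halted_by_mono) simp
  then have "?end (t0 + n + s)" using n by (intro conjI exI[of _ n]) simp_all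
  then have end1: "?end s1" unfolding s1_def by (rule LeastI)
  have before: "\<not> ?end s" if "s < s1" for s
    using that unfolding s1_def by (rule not_less_Least)
  have "s \<le> s1 \<longrightarrow> phase_start \<rho> s = t0 \<and> phase \<rho> s = phase \<rho> t0" if "t0 \<le> s" for s
    using that
  proof (induction s rule: dec_induct)
    case base
    show ?case using t0 by simp
  next
    case (step s)
    show ?case
    proof
      assume "Suc s \<le> s1"
      then have "phase_start \<rho> s = t0" "phase \<rho> s = phase \<rho> t0" "\<not> ?end s"
        using step.IH before[of s] by auto
      then have "phase_start \<rho> (Suc s) = t0" using step.hyps by auto
      then show "phase_start \<rho> (Suc s) = t0 \<and> phase \<rho> (Suc s) = phase \<rho> t0"
        using \<open>phase \<rho> s = phase \<rho> t0\<close> step.hyps by (simp del: phase_start.simps)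
    qed
  qed
  then show ?thesis using that end1 by blast
qed

text \<open>
  The bound \<open>k \<le> t0\<close> says that late phases start at late stages.
\<close>

lemma phase_exists:
  assumes unb: "\<And>t. \<exists>n. t < \<rho> n"
  shows "\<exists>t0\<ge>k. phase_start \<rho> t0 = t0 \<and> phase \<rho> t0 = k"
proof (induction k)
  case 0
  show ?case by (rule exI[of _ 0]) simp
next
  case (Suc k)
  then obtain t0 where t0: "k \<le> t0" "phase_start \<rho> t0 = t0" "phase \<rho> t0 = k" by blast
  obtain s1 n where s1: "t0 \<le> s1"
    "\<And>s. t0 \<le> s \<Longrightarrow> s \<le> s1 \<Longrightarrow> phase_start \<rho> s = t0 \<and> phase \<rho> s = phase \<rho> t0"
    "n \<le> s1" "halted_by n s1" "t0 < \<rho> n"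
    using phase_interval[OF unb t0(2)] by blast
  have "phase_start \<rho> s1 = t0" "phase \<rho> s1 = k"
    using s1(2)[OF s1(1) order_refl] t0(3) by simp_all
  moreover from this(1) have "\<exists>n\<le>s1. halted_by n s1 \<and> phase_start \<rho> s1 < \<rho> n"
    using s1(3-5) by metis
  ultimately have "phase_start \<rho> (Suc s1) = Suc s1" by (simp only: phase_start.simps if_True)
  moreover from this have "phase \<rho> (Suc s1) = Suc k"
    using \<open>phase \<rho> s1 = k\<close> by (simp only: phase.simps simp_thms if_True)
  ultimately show ?case using t0(1) s1(1) by (intro exI[of _ "Suc s1"]) simp
qed

text \<open>
  Side \<open>True\<close> is held back in the phases with odd number and side \<open>False\<close> in the others, so at each stage the
  bound \<open>visible \<rho> i s\<close> equals \<open>s\<close> for one of the two sides.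
\<close>

definition visible :: "(nat \<Rightarrow> nat) \<Rightarrow> bool \<Rightarrow> nat \<Rightarrow> nat" where
  "visible \<rho> i s = (if odd (phase \<rho> s) = i then phase_start \<rho> s else s)"

text \<open>
  The argument \<open>push s y\<close> stands for the request to show \<open>y\<close> at stage \<open>s\<close>.
\<close>

definition delay :: "(nat \<Rightarrow> nat) \<Rightarrow> bool \<Rightarrow> nat \<Rightarrow> nat" where
  "delay \<rho> i x = (if top_of x \<le> visible \<rho> i (pop x) then top_of x else 0)"

lemma phase_start_le: "phase_start \<rho> s \<le> s"
  by (induction s) auto

lemma visible_le: "visible \<rho> i s \<le> s"
  by (simp add: visible_def phase_start_le)

lemma delay_push: "y \<le> s \<Longrightarrow> odd (phase \<rho> s) \<noteq> i \<Longrightarrow> delay \<rho> i (push s y) = y"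
  by (simp add: delay_def visible_def)

lemma prim_rec_delay:
  assumes "prim_rec_fun \<rho>" shows "prim_rec_fun (delay \<rho> i)"
proof -
  have "pr_pred 1 (\<lambda>xs. odd (phase \<rho> (pop (xs ! 0))))"
    by (intro pr_intros pr_on_app[OF prim_rec_phase[OF assms]]) simp
  from this pr_pred_not[OF this] have "pr_pred 1 (\<lambda>xs. odd (phase \<rho> (pop (xs ! 0))) = i)"
    by (cases i) simp_all
  then have "pr_on 1 (\<lambda>xs. delay \<rho> i (xs ! 0))"
    unfolding delay_def visible_def
    by (intro pr_intros pr_on_app[OF prim_rec_phase_start[OF assms]]) simp_all
  then show ?thesis by (simp add: prim_rec_fun_iff)
qed

lemma surj_delay:
  assumes unb: "\<And>t. \<exists>n. t < \<rho> n"
  shows "surj (delay \<rho> i)"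
  unfolding surj_def
proof
  fix y
  define k where "k = (if odd y = i then Suc y else y)"
  obtain t where t: "k \<le> t" "phase \<rho> t = k" using phase_exists[OF unb] by blast
  have "y \<le> k" "odd k \<noteq> i" by (auto simp: k_def)
  with t have "y = delay \<rho> i (push t y)" by (simp add: delay_push)
  then show "\<exists>x. y = delay \<rho> i x" by blast
qed

text \<open>
  The clock bounds the values of a supposed reduction \<open>f\<close> on \<open>{0..n}\<close> by the end \<open>s1\<close> of a late phase in which
  side \<open>i\<close> is held back at \<open>t\<close>. Up to \<open>s1\<close>, side \<open>i\<close> shows only numbers up to \<open>t\<close>, which
  contradicts the pigeonhole principle.
\<close>

lemma not_le_pullback_delay:
  assumes R: "punctual R"
  shows "\<not> R \<le>pr pullback (delay (least_rep R) i) R"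
proof
  let ?\<rho> = "least_rep R"
  let ?g = "delay ?\<rho> i"
  assume "R \<le>pr pullback ?g R"
  then have "\<exists>f. prim_rec_fun f \<and> (\<forall>x y. (x, y) \<in> R \<longleftrightarrow> (?g (f x), ?g (f y)) \<in> R)"
    by (simp only: pr_le_def pullback_def mem_Collect_eq prod.case)
  then obtain f where f: "prim_rec_fun f" "\<forall>x y. (x, y) \<in> R \<longleftrightarrow> (?g (f x), ?g (f y)) \<in> R"
    by (elim exE conjE)
  obtain N where N: "\<And>n s x. N \<le> n \<Longrightarrow> halted_by n s \<Longrightarrow> x \<le> n \<Longrightarrow> f x \<le> s"
    using halted_by_dominates[OF f(1)] by blast
  \<comment> \<open>A phase number that belongs to side \<open>i\<close> and is large enough for all \<open>n\<close> beyond the start of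
      the phase to be at least \<open>N\<close>.\<close>
  define k where "k = (if odd N = i then N else Suc N)"
  have k: "N \<le> k" "odd k = i" by (auto simp: k_def)
  obtain t where t: "k \<le> t" "phase_start ?\<rho> t = t" "phase ?\<rho> t = k"
    using phase_exists[OF least_rep_unbounded[OF R]] by blast
  obtain s1 n where s1:
    "\<And>s. t \<le> s \<Longrightarrow> s \<le> s1 \<Longrightarrow> phase_start ?\<rho> s = t \<and> phase ?\<rho> s = k"
    "halted_by n s1" "t < ?\<rho> n"
    using phase_interval[OF least_rep_unbounded[OF R] t(2)] t(3) by metis
  have n: "t < n" using s1(3) least_rep_le[OF R, of n] by simp
  have g_le: "?g (f x) \<le> t" if "x \<le> n" for x
  proof -
    have "f x \<le> s1" using N[OF _ s1(2) that] n t(1) k(1) by simp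
    then have "pop (f x) \<le> s1" using pop_le order_trans by blast
    \<comment> \<open>Before stage \<open>t\<close> the bound is below \<open>t\<close> since it never exceeds the stage; from \<open>t\<close> to \<open>s1\<close>
        side \<open>i\<close> is held back.\<close>
    then have "visible ?\<rho> i (pop (f x)) \<le> t"
      using s1(1)[of "pop (f x)"] k(2) visible_le[of ?\<rho> i "pop (f x)"]
      by (cases "t \<le> pop (f x)") (auto simp: visible_def)
    then show ?thesis by (auto simp: delay_def)
  qed
  \<comment> \<open>The classes that meet \<open>{0..t}\<close>, represented by their least elements.\<close>
  define M where "M = {j. j \<le> t \<and> ?\<rho> j = j}"
  have canonical: "?\<rho> x = x" if "x \<in> insert (?\<rho> n) M" for x
    using that least_rep_idem[OF R] by (auto simp: M_def)
  have "inj_on (\<lambda>x. ?\<rho> (?g (f x))) (insert (?\<rho> n) M)"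
  proof (rule inj_onI)
    fix x y assume xy: "x \<in> insert (?\<rho> n) M" "y \<in> insert (?\<rho> n) M" "?\<rho> (?g (f x)) = ?\<rho> (?g (f y))"
    then have "(?g (f x), ?g (f y)) \<in> R" by (simp only: least_rep_eq_iff[OF R])
    then have "(x, y) \<in> R" by (rule f(2)[rule_format, THEN iffD2])
    then have "?\<rho> x = ?\<rho> y" by (simp only: least_rep_eq_iff[OF R])
    then show "x = y" using canonical xy(1,2) by metis
  qed
  moreover have "(\<lambda>x. ?\<rho> (?g (f x))) ` insert (?\<rho> n) M \<subseteq> M"
  proof -
    have "?\<rho> (?g (f x)) \<in> M" if "x \<le> n" for x
      using g_le[OF that] least_rep_le[OF R] least_rep_idem[OF R] by (auto simp: M_def intro: order_trans)
    then show ?thesis using n least_rep_le[OF R, of n] by (auto simp: M_def)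
  qed
  moreover have "finite M" by (simp add: M_def)
  ultimately have "card (insert (?\<rho> n) M) \<le> card M"
    by (metis card_inj_on_le)
  moreover have "?\<rho> n \<notin> M" using s1(3) by (simp add: M_def)
  ultimately show False using \<open>finite M\<close> by simp
qed

section \<open>The two copies join to the relation\<close>

text \<open>
  \<open>u\<close> codes a finite set of numbers by its binary digits (\<open>set_decode\<close>), and \<open>c x 0, c x 1, \<dots>\<close> are the candidates
  for the value at \<open>x\<close>; the first candidate outside the set is chosen.
\<close>

definition fresh :: "(nat \<Rightarrow> nat \<Rightarrow> nat) \<Rightarrow> nat \<Rightarrow> nat \<Rightarrow> nat" where
  "fresh c u x = c x (LEAST y. y = x \<or> even (u div 2 ^ c x y))"

text \<open>
  The code of the set of values chosen for the fixed points of \<open>\<rho>\<close> below \<open>x\<close>. Carrying this set along reduces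
  the course-of-values recursion for the greedy choice to a primitive recursion.
\<close>

primrec used :: "(nat \<Rightarrow> nat) \<Rightarrow> (nat \<Rightarrow> nat \<Rightarrow> nat) \<Rightarrow> nat \<Rightarrow> nat" where
  "used \<rho> c 0 = 0"
| "used \<rho> c (Suc x) =
    (if \<rho> x = x then used \<rho> c x + 2 ^ fresh c (used \<rho> c x) x else used \<rho> c x)"

text \<open>
  There are more candidates at \<open>x\<close> than values chosen before, so one of them is new. Hence the choices are
  pairwise distinct.
\<close>

lemma inj_on_greedy:
  assumes inj: "\<And>x. \<rho> x = x \<Longrightarrow> inj_on (c x) {y. y \<le> x \<and> \<rho> y = y}"
  defines "h \<equiv> \<lambda>x. fresh c (used \<rho> c x) x"
  shows "set_decode (used \<rho> c x) = h ` {y. y < x \<and> \<rho> y = y} \<and> inj_on h {y. y < x \<and> \<rho> y = y}"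
proof (induction x)
  case (Suc x)
  let ?M = "\<lambda>x. {y. y < x \<and> \<rho> y = y}"
  let ?u = "used \<rho> c x"
  show ?case
  proof (cases "\<rho> x = x")
    case False
    then have "?M (Suc x) = ?M x" by (auto simp: less_Suc_eq)
    with Suc False show ?thesis by simp
  next
    case True
    have M: "?M (Suc x) = insert x (?M x)" "{y. y \<le> x \<and> \<rho> y = y} = insert x (?M x)"
      using True by auto
    have fin: "finite (?M x)" by simp
    have card_u: "card (set_decode ?u) \<le> card (?M x)"
      using Suc card_image_le[OF fin, of h] by simp
    have "\<not> c x ` insert x (?M x) \<subseteq> set_decode ?u"
    proof
      assume "c x ` insert x (?M x) \<subseteq> set_decode ?u"
      then have "card (c x ` insert x (?M x)) \<le> card (set_decode ?u)"
        by (rule card_mono[rotated]) simp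
      moreover have "card (c x ` insert x (?M x)) = Suc (card (?M x))"
        using inj[OF True] M(2) by (simp add: card_image)
      ultimately show False using card_u by simp
    qed
    then obtain y where "y \<in> insert x (?M x)" and new_y: "c x y \<notin> set_decode ?u" by blast
    then have "y \<le> x" by auto
    define z where "z = (LEAST y. y = x \<or> even (?u div 2 ^ c x y))"
    have "z \<le> y" unfolding z_def
      using new_y by (intro Least_le) (simp add: set_decode_def)
    moreover have "z = x \<or> even (?u div 2 ^ c x z)"
      unfolding z_def by (rule LeastI[of _ x]) simp
    \<comment> \<open>If the search runs into its bound \<open>x\<close>, then \<open>z = y\<close>, as \<open>z \<le> y \<le> x\<close>.\<close>
    ultimately have "c x z \<notin> set_decode ?u"
      using \<open>y \<le> x\<close> new_y by (cases "z = x") (auto simp: set_decode_def)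
    then have new: "h x \<notin> set_decode ?u" by (simp add: h_def fresh_def z_def)
    have "?u + 2 ^ h x = set_encode (insert (h x) (set_decode ?u))"
      using new by (simp add: set_encode_insert)
    then have "set_decode (used \<rho> c (Suc x)) = insert (h x) (set_decode ?u)"
      using True by (simp add: h_def set_encode_inverse)
    then show ?thesis using Suc M(1) new by (auto simp: inj_on_insert)
  qed
qed auto

lemma prim_rec_greedy:
  assumes \<rho>: "prim_rec_fun \<rho>"
    and c: "\<And>n f g. pr_on n f \<Longrightarrow> pr_on n g \<Longrightarrow> pr_on n (\<lambda>xs. c (f xs) (g xs))"
  shows "prim_rec_fun (\<lambda>x. fresh c (used \<rho> c x) x)"
proof -
  have fresh: "pr_on n (\<lambda>xs. fresh c (f xs) (g xs))" if "pr_on n f" "pr_on n g" for n f g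
  proof -
    have "pr_on n (\<lambda>xs. c (g xs) (LEAST y. y = g xs \<or> \<not> odd (f xs div 2 ^ c (g xs) y)))"
      by (intro c that pr_intros pr_on_drop1) simp
    then show ?thesis by (simp add: fresh_def)
  qed
  have eq: "used \<rho> c x = rec_nat 0 (\<lambda>x u. if \<rho> x = x then u + 2 ^ fresh c u x else u) x" for x
    by (induction x) simp_all
  have "pr_on 1 (\<lambda>xs. fresh c
      (rec_nat 0 (\<lambda>x u. if \<rho> x = x then u + 2 ^ fresh c u x else u) (xs ! 0)) (xs ! 0))"
    by (intro fresh pr_on_rec_nat pr_intros pr_on_app[OF \<rho>]) simp_all
  then show ?thesis by (simp only: prim_rec_fun_iff eq)
qed

text \<open>
  At stage \<open>x\<close> the reduction of the side that is not held back is injective on the classes that meet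
  \<open>{0..x}\<close>, so its values \<open>f i (push x y)\<close>, normalised to least representatives with respect to \<open>T\<close>, are
  suitable candidates for the greedy choice.
\<close>

lemma pullback_delay_join:
  assumes R: "punctual R" and T: "punctual T"
    and le: "\<And>i. pullback (delay (least_rep R) i) R \<le>pr T"
  shows "R \<le>pr T"
proof -
  let ?\<rho> = "least_rep R"
  obtain f where f: "\<And>i. prim_rec_fun (f i)"
    "\<And>i x y. (delay ?\<rho> i x, delay ?\<rho> i y) \<in> R \<longleftrightarrow> (f i x, f i y) \<in> T"
    using le unfolding pr_le_def pullback_def by simp metis
  define c where "c x y = least_rep T (if odd (phase ?\<rho> x) then f False (push x y) else f True (push x y))"
    for x y
  define h where "h x = fresh c (used ?\<rho> c x) x" for x
  have "pr_on n (\<lambda>xs. c (a xs) (b xs))" if "pr_on n a" "pr_on n b" for n a b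
    unfolding c_def
    by (intro pr_on_least_rep[OF T] pr_on_app[OF f(1)] pr_on_app[OF prim_rec_phase]
        prim_rec_least_rep[OF R] that pr_intros)
  then have "prim_rec_fun h"
    unfolding h_def by (intro prim_rec_greedy prim_rec_least_rep[OF R])
  then have "prim_rec_fun (\<lambda>x. h (?\<rho> x))"
    unfolding prim_rec_fun_iff[of "\<lambda>x. h (?\<rho> x)"]
    by (intro pr_on_app[of h] pr_on_least_rep[OF R] pr_intros) simp_all
  moreover have "(x, y) \<in> R \<longleftrightarrow> (h (?\<rho> x), h (?\<rho> y)) \<in> T" for x y
  proof -
    have c_inj: "inj_on (c x) {y. y \<le> x \<and> ?\<rho> y = y}" for x
    proof (rule inj_onI)
      fix y z assume yz: "y \<in> {y. y \<le> x \<and> ?\<rho> y = y}" "z \<in> {y. y \<le> x \<and> ?\<rho> y = y}" "c x y = c x z"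
      define i where "i = (\<not> odd (phase ?\<rho> x))"
      have "c x v = least_rep T (f i (push x v))" for v by (simp add: c_def i_def)
      then have "(f i (push x y), f i (push x z)) \<in> T"
        using yz(3) by (simp add: least_rep_eq_iff[OF T])
      then have "(delay ?\<rho> i (push x y), delay ?\<rho> i (push x z)) \<in> R"
        by (simp only: f(2))
      then have "(y, z) \<in> R" using yz(1,2) by (simp add: delay_push i_def)
      then have "?\<rho> y = ?\<rho> z" by (simp add: least_rep_eq_iff[OF R])
      then show "y = z" using yz(1,2) by simp
    qed
    have "least_rep T (h v) = h v" for v
      by (simp add: h_def fresh_def c_def least_rep_idem[OF T])
    then have "(h (?\<rho> x), h (?\<rho> y)) \<in> T \<longleftrightarrow> h (?\<rho> x) = h (?\<rho> y)"
      by (simp flip: least_rep_eq_iff[OF T])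
    also have "\<dots> \<longleftrightarrow> ?\<rho> x = ?\<rho> y"
    proof
      have "inj_on h {v. v < Suc (x + y) \<and> ?\<rho> v = v}"
        using inj_on_greedy[of ?\<rho> c] c_inj unfolding h_def by blast
      moreover have "?\<rho> x < Suc (x + y)" "?\<rho> y < Suc (x + y)"
        using least_rep_le[OF R, of x] least_rep_le[OF R, of y] by simp_all
      ultimately show "h (?\<rho> x) = h (?\<rho> y) \<Longrightarrow> ?\<rho> x = ?\<rho> y"
        by (auto simp: least_rep_idem[OF R] dest: inj_onD)
    qed simp
    finally show ?thesis by (simp add: least_rep_eq_iff[OF R])
  qed
  ultimately show ?thesis unfolding pr_le_def by blast
qed

section \<open>Join-reducibility\<close>

theorem punctual_join_reducible:
  assumes R: "punctual R"
  shows "join_reducible Peq (peq_degree R)"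
  unfolding join_reducible_degree_iff[OF R]
proof (intro exI conjI allI impI)
  let ?S = "\<lambda>i. pullback (delay (least_rep R) i) R"
  have g: "prim_rec_fun (delay (least_rep R) i)" for i
    by (rule prim_rec_delay) (rule prim_rec_least_rep[OF R])
  show "punctual (?S False)" "punctual (?S True)"
    by (rule punctual_pullback[OF R g surj_delay[OF least_rep_unbounded[OF R]]])+
  show "?S False <pr R" "?S True <pr R"
    by (simp_all add: pr_less_def pullback_le g not_le_pullback_delay[OF R])
  fix T assume "punctual T" "?S False \<le>pr T" "?S True \<le>pr T"
  then show "R \<le>pr T"
    by (intro pullback_delay_join[OF R]) (metis (full_types))+
qed

theorem theorem7p3:
  fixes Z :: "nat set"
  assumes "punctual (rel_of_set Z)"
  shows "join_reducible Peq (peq_degree (rel_of_set Z))"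
  using assms by (rule punctual_join_reducible)

end
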